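(* Let $\mathcal{A}$ be a free $\mathbb{Z}[v,v^{-1}]$-module with a basis $\{E_a : a\in L\}$ indexed by a partially ordered set $(L,\prec)$ such that, for any $a\in L$, the lengths of chains in $L$ with top element $a$ are bounded from above. Let $x\mapsto\overline{x}$ be a $\mathbb{Z}$-linear involution on $\mathcal{A}$ such that $\overline{f\,x}=\overline{f}\,\overline{x}$ for all $f\in\mathbb{Z}[v,v^{-1}]$ and $x\in\mathcal{A}$, where $\overline{f}(v)=f(v^{-1})$. Suppose that $$\overline{E_a}-E_a\in\bigoplus_{a'\prec a}\mathbb{Z}[v,v^{-1}]E_{a'}\qquad(a\in L).$$ Then for every $a\in L$ there exists a unique element $C_a\in\mathcal{A}$ such that $$\overline{C_a}=C_a\qquad\text{and}\qquad C_a-E_a\in\bigoplus_{a'\in L}v\mathbb{Z}[v]E_{a'}.$$ Moreover, the element $C_a$ satisfies $$C_a-E_a\in\bigoplus_{a'\prec a}v\mathbb{Z}[v]E_{a'},$$ hence the elements $C_a$ for $a\in L$ form a $\mathbb{Z}[v,v^{-1}]$-basis of $\mathcal{A}$.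
   Context: $v$ is an indeterminate. Here $\prec$ denotes the strict relation of the partial order. An involution is a map whose square is the identity. *)

theory Defs
  imports Complex_Main "HOL-Library.Poly_Mapping"
begin

text \<open>Finitely supported maps from \<open>int\<close> to \<open>int\<close> under convolution are the group ring of
  \<open>\<int>\<close> over \<open>\<int>\<close>, i.e. \<open>\<int>[v, v\<^sup>-\<^sup>1]\<close>: the key \<open>k\<close> carries the coefficient of \<open>v\<^sup>k\<close>.\<close>

type_synonym laurent_poly = "int \<Rightarrow>\<^sub>0 int"

definition lvar :: laurent_poly
  where "lvar = Poly_Mapping.single 1 1"

text \<open>The substitution \<open>v \<mapsto> v\<^sup>-\<^sup>1\<close>; \<open>map_key\<close> precomposes the coefficient function.\<close>

definition laurent_bar :: "laurent_poly \<Rightarrow> laurent_poly"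
  where "laurent_bar f = Poly_Mapping.map_key uminus f"

lemma lookup_laurent_bar:
  "Poly_Mapping.lookup (laurent_bar f) k = Poly_Mapping.lookup f (- k)"
  unfolding laurent_bar_def by (simp add: map_key.rep_eq)

text \<open>\<open>\<int>[v]\<close> and \<open>v\<int>[v]\<close> as subsets of \<open>\<int>[v, v\<^sup>-\<^sup>1]\<close>.\<close>

definition polys_v :: "laurent_poly set"
  where "polys_v = {f. \<forall>k \<in> Poly_Mapping.keys f. 0 \<le> k}"

definition v_polys_v :: "laurent_poly set"
  where "v_polys_v = (\<lambda>f. lvar * f) ` polys_v"

text \<open>The sum of the \<open>M E\<^sub>a\<close> over \<open>a \<in> S\<close>, for a set \<open>M\<close> of scalars that is an additive
  subgroup; the sum is direct whenever the \<open>E\<^sub>a\<close> are linearly independent.\<close>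

definition coeff_sums ::
    "('r::comm_ring_1 \<Rightarrow> 'm::ab_group_add \<Rightarrow> 'm) \<Rightarrow> 'r set \<Rightarrow> ('l \<Rightarrow> 'm) \<Rightarrow> 'l set \<Rightarrow> 'm set"
  where "coeff_sums scale M E S =
    {\<Sum>a\<in>F. scale (f a) (E a) | F f. finite F \<and> F \<subseteq> S \<and> (\<forall>a\<in>F. f a \<in> M)}"

text \<open>An indexed family is a basis only if it has no repetitions, hence the injectivity.\<close>

definition is_basis ::
    "('r::comm_ring_1 \<Rightarrow> 'm::ab_group_add \<Rightarrow> 'm) \<Rightarrow> ('l \<Rightarrow> 'm) \<Rightarrow> 'l set \<Rightarrow> bool"
  where "is_basis scale E L \<longleftrightarrow>
    inj_on E L \<and> \<not> module.dependent scale (E ` L) \<and> module.span scale (E ` L) = UNIV"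

text \<open>\<open>r\<close> is a reflexive order relation. Requiring chains to be finite as well only excludes
  the value \<open>card C = 0\<close> of infinite chains.\<close>

definition bounded_chains_below :: "'l set \<Rightarrow> ('l \<times> 'l) set \<Rightarrow> bool"
  where "bounded_chains_below L r \<longleftrightarrow>
    (\<forall>a\<in>L. \<exists>N. \<forall>C \<in> Chains r.
        a \<in> C \<and> (\<forall>c\<in>C. (c, a) \<in> r) \<longrightarrow> finite C \<and> card C \<le> N)"

end

theory Submission
  imports Defs
begin

text \<open>The boundedness of chains gives every \<open>a \<in> L\<close> a height \<open>h a\<close>, the largest length of a
  chain with top \<open>a\<close>, and \<open>h\<close> is strictly increasing.  The involution is unitriangular, so at an
  element \<open>a\<close> that lies strictly below no element of the support of \<open>y\<close>, the coefficient of
  \<open>bar y\<close> is obtained from that of \<open>y\<close> by \<open>v \<mapsto> v\<^sup>-\<^sup>1\<close> (lemma \<open>coord_bar_top\<close>).  The theorem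
  rests on two consequences.

  First, if \<open>bar y = y\<close> and all coefficients of \<open>y\<close> lie in \<open>v\<int>[v]\<close>, then \<open>y = 0\<close>: a coefficient of
  maximal height would be a nonzero element of \<open>v\<int>[v]\<close> fixed by \<open>v \<mapsto> v\<^sup>-\<^sup>1\<close>
  (lemma \<open>bar_fixed_v_polys_eq_0\<close>).  This is uniqueness.

  Secondly, if \<open>bar x = - x\<close> and \<open>x\<close> is supported on a down-closed set \<open>S\<close> of bounded height, then
  \<open>x = y - bar y\<close> for some \<open>y\<close> supported on \<open>S\<close> with coefficients in \<open>v\<int>[v]\<close>
  (lemma \<open>bar_anti_fixed_decomp\<close>).
  Induction on the height bound: a coefficient \<open>f\<close> of maximal height satisfies
  \<open>f(v\<^sup>-\<^sup>1) = - f(v)\<close>, hence \<open>f = g(v) - g(v\<^sup>-\<^sup>1)\<close> with \<open>g\<close> the part of \<open>f\<close> in positive degrees;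
  subtracting the corresponding terms lowers the height.  Applied to \<open>x = bar (E a) - E a\<close>, which
  is supported strictly below \<open>a\<close>, this yields \<open>C\<^sub>a = E a + y\<close>.

  By uniqueness every admissible family is the constructed one, hence it is unitriangular over the
  basis \<open>E\<close>, and so it is a basis itself (lemma \<open>unitriangular_basis\<close>).\<close>

section \<open>Laurent polynomials\<close>

lemma lookup_single_1_mult:
  fixes f :: laurent_poly
  shows "Poly_Mapping.lookup (Poly_Mapping.single j 1 * f) k = Poly_Mapping.lookup f (k - j)"
proof -
  have "Poly_Mapping.lookup (Poly_Mapping.single j 1 * f) k =
      Sum_any (\<lambda>l. Sum_any (\<lambda>q. (Poly_Mapping.lookup f q when k = l + q)) when l = j)"
    unfolding lookup_mult lookup_single by (rule Sum_any.cong) (auto simp: when_def)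
  also have "\<dots> = Sum_any (\<lambda>q. (Poly_Mapping.lookup f q when k = j + q))"
    by simp
  also have "\<dots> = Sum_any (\<lambda>q. (Poly_Mapping.lookup f q when q = k - j))"
    by (rule Sum_any.cong) (auto simp: when_def)
  finally show ?thesis by simp
qed

lemma v_polys_v_iff:
  "f \<in> v_polys_v \<longleftrightarrow> (\<forall>k\<le>0. Poly_Mapping.lookup f k = 0)"
proof
  assume "f \<in> v_polys_v"
  then obtain g where g: "g \<in> polys_v" "f = lvar * g" by (auto simp: v_polys_v_def)
  show "\<forall>k\<le>0. Poly_Mapping.lookup f k = 0"
  proof (intro allI impI)
    fix k :: int assume "k \<le> 0"
    then have "k - 1 \<notin> Poly_Mapping.keys g" using g(1) by (force simp: polys_v_def)
    then show "Poly_Mapping.lookup f k = 0"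
      by (simp add: g(2) lvar_def lookup_single_1_mult in_keys_iff)
  qed
next
  assume *: "\<forall>k\<le>0. Poly_Mapping.lookup f k = 0"
  define g :: laurent_poly where "g = Poly_Mapping.single (-1) 1 * f"
  have "g \<in> polys_v"
    unfolding polys_v_def
  proof (intro CollectI ballI)
    fix k assume "k \<in> Poly_Mapping.keys g"
    then have "Poly_Mapping.lookup f (k + 1) \<noteq> 0"
      by (simp add: g_def in_keys_iff lookup_single_1_mult)
    then have "\<not> k + 1 \<le> 0" using * by blast
    then show "0 \<le> k" by simp
  qed
  moreover have "f = lvar * g"
    by (rule poly_mapping_eqI) (simp add: g_def lvar_def lookup_single_1_mult)
  ultimately show "f \<in> v_polys_v" by (auto simp: v_polys_v_def)
qed

lemma zero_in_v_polys_v: "0 \<in> v_polys_v"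
  by (simp add: v_polys_v_iff)

lemma v_polys_v_add: "f \<in> v_polys_v \<Longrightarrow> g \<in> v_polys_v \<Longrightarrow> f + g \<in> v_polys_v"
  by (simp add: v_polys_v_iff lookup_add)

lemma v_polys_v_diff: "f \<in> v_polys_v \<Longrightarrow> g \<in> v_polys_v \<Longrightarrow> f - g \<in> v_polys_v"
  by (simp add: v_polys_v_iff lookup_minus)

lemma laurent_bar_0 [simp]: "laurent_bar 0 = 0"
  by (rule poly_mapping_eqI) (simp add: lookup_laurent_bar)

lemma laurent_bar_fixed_v_polys_v:
  assumes "f \<in> v_polys_v" "laurent_bar f = f"
  shows "f = 0"
proof (rule poly_mapping_eqI)
  fix k :: int
  have "Poly_Mapping.lookup f k = Poly_Mapping.lookup f (- k)"
    using assms(2) lookup_laurent_bar[of f k] by simp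
  moreover have "k \<le> 0 \<or> - k \<le> 0" by linarith
  ultimately show "Poly_Mapping.lookup f k = Poly_Mapping.lookup 0 k"
    using assms(1) by (auto simp: v_polys_v_iff)
qed

text \<open>The part of a Laurent polynomial in positive degrees.\<close>

definition laurent_pos :: "laurent_poly \<Rightarrow> laurent_poly"
  where "laurent_pos f = Poly_Mapping.mapp (\<lambda>k c. if 0 < k then c else 0) f"

lemma lookup_laurent_pos:
  "Poly_Mapping.lookup (laurent_pos f) k = (if 0 < k then Poly_Mapping.lookup f k else 0)"
  by (auto simp: laurent_pos_def lookup_mapp when_def in_keys_iff)

lemma laurent_pos_in_v_polys_v: "laurent_pos f \<in> v_polys_v"
  by (simp add: v_polys_v_iff lookup_laurent_pos)

lemma laurent_pos_decomp:
  assumes "laurent_bar f = - f"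
  shows "f = laurent_pos f - laurent_bar (laurent_pos f)"
proof (rule poly_mapping_eqI)
  fix k :: int
  have "Poly_Mapping.lookup f (- k) = - Poly_Mapping.lookup f k"
    using assms lookup_laurent_bar[of f k] by simp
  then show "Poly_Mapping.lookup f k =
      Poly_Mapping.lookup (laurent_pos f - laurent_bar (laurent_pos f)) k"
    by (cases k "0 :: int" rule: linorder_cases)
      (auto simp: lookup_minus lookup_laurent_bar lookup_laurent_pos)
qed

section \<open>Coordinates with respect to an indexed basis\<close>

text \<open>Linear independence of the family excludes repetitions as well: \<open>C a = C b\<close> with \<open>a \<noteq> b\<close>
  would be a relation with coefficients \<open>1\<close> and \<open>- 1\<close>, which is nontrivial because \<open>0 \<noteq> 1\<close>.\<close>

lemma (in module) is_basisI:
  fixes C :: "'l \<Rightarrow> 'b"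
  assumes nontriv: "(0 :: 'a) \<noteq> 1"
    and indep: "\<And>F f a. \<lbrakk>finite F; F \<subseteq> L; (\<Sum>a\<in>F. scale (f a) (C a)) = 0; a \<in> F\<rbrakk> \<Longrightarrow> f a = 0"
    and gen: "span (C ` L) = UNIV"
  shows "is_basis scale C L"
  unfolding is_basis_def
proof (intro conjI)
  show inj: "inj_on C L"
  proof (rule inj_onI, rule ccontr)
    fix a b assume ab: "a \<in> L" "b \<in> L" "C a = C b" "a \<noteq> b"
    have "(\<Sum>c\<in>{a, b}. scale (if c = a then 1 else - 1) (C c)) = 0"
      using ab by simp
    from indep[OF _ _ this, of a] ab nontriv show False by simp
  qed
  show "\<not> dependent (C ` L)"
  proof
    assume "dependent (C ` L)"
    then obtain t u x where t: "finite t" "t \<subseteq> C ` L" "(\<Sum>v\<in>t. scale (u v) v) = 0"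
      and x: "x \<in> t" "u x \<noteq> 0"
      unfolding dependent_explicit by blast
    obtain F where F: "F \<subseteq> L" "finite F" "t = C ` F"
      using finite_subset_image[OF t(1,2)] by blast
    have "(\<Sum>a\<in>F. scale (u (C a)) (C a)) = 0"
      using t(3) sum.reindex[OF inj_on_subset[OF inj F(1)], of "\<lambda>v. scale (u v) v"]
      by (simp add: F(3))
    from indep[OF F(2,1) this] x F(3) show False by auto
  qed
  show "span (C ` L) = UNIV" by (rule gen)
qed

text \<open>A free module with a basis \<open>E\<close> indexed by \<open>L\<close>.\<close>

locale based_module = module scale
  for scale :: "'r::comm_ring_1 \<Rightarrow> 'm::ab_group_add \<Rightarrow> 'm" +
  fixes E :: "'l \<Rightarrow> 'm" and L :: "'l set"
  assumes basis: "is_basis scale E L"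
begin

lemma inj_E: "inj_on E L" and indep_E: "independent (E ` L)" and in_span_E: "x \<in> span (E ` L)"
  using basis by (auto simp: is_basis_def)

text \<open>The coefficient of \<open>x\<close> at \<open>E a\<close>, extended by \<open>0\<close> to indices outside \<open>L\<close>.\<close>

definition coord :: "'m \<Rightarrow> 'l \<Rightarrow> 'r"
  where "coord x a = (if a \<in> L then representation (E ` L) x (E a) else 0)"

lemma coord_notin [simp]: "a \<notin> L \<Longrightarrow> coord x a = 0"
  by (simp add: coord_def)

lemma coord_zero [simp]: "coord 0 a = 0"
  by (simp add: coord_def representation_zero)

lemma coord_add: "coord (x + y) a = coord x a + coord y a"
  by (simp add: coord_def representation_add indep_E in_span_E)

lemma coord_diff: "coord (x - y) a = coord x a - coord y a"
  by (simp add: coord_def representation_diff indep_E in_span_E)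

lemma coord_minus: "coord (- x) a = - coord x a"
  by (simp add: coord_def representation_neg indep_E in_span_E)

lemma coord_scale: "coord (scale c x) a = c * coord x a"
  by (simp add: coord_def representation_scale indep_E in_span_E)

lemma coord_sum: "coord (\<Sum>i\<in>I. f i) a = (\<Sum>i\<in>I. coord (f i) a)"
  by (induction I rule: infinite_finite_induct) (simp_all add: coord_add)

lemma coord_E: "b \<in> L \<Longrightarrow> coord (E b) a = (if a = b then 1 else 0)"
  using inj_E by (auto simp: coord_def representation_basis indep_E inj_on_eq_iff)

lemma coord_sum_E:
  assumes "finite F" "F \<subseteq> L"
  shows "coord (\<Sum>b\<in>F. scale (f b) (E b)) a = (if a \<in> F then f a else 0)"
proof -
  have "coord (\<Sum>b\<in>F. scale (f b) (E b)) a = (\<Sum>b\<in>F. if a = b then f b else 0)"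
    unfolding coord_sum coord_scale using assms(2)
    by (intro sum.cong refl) (auto simp: coord_E)
  then show ?thesis using assms(1) by simp
qed

lemma finite_coord: "finite {a. coord x a \<noteq> 0}"
proof -
  have "finite (E -` {b. representation (E ` L) x b \<noteq> 0} \<inter> L)"
    by (rule finite_vimage_IntI[OF finite_representation inj_E])
  then show ?thesis
    by (rule rev_finite_subset) (auto simp: coord_def split: if_splits)
qed

lemma coord_support_subset: "{a. coord x a \<noteq> 0} \<subseteq> L"
  by (auto intro: ccontr)

lemma sum_coord: "(\<Sum>a | coord x a \<noteq> 0. scale (coord x a) (E a)) = x"
proof -
  let ?S = "{a. coord x a \<noteq> 0}" and ?R = "representation (E ` L) x"
  have inj: "inj_on E ?S" by (rule inj_on_subset[OF inj_E coord_support_subset])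
  have img: "E ` ?S = {b. ?R b \<noteq> 0}"
    using representation_ne_zero[of "E ` L" x]
    by (auto simp: coord_def image_iff split: if_splits)
  have "(\<Sum>a\<in>?S. scale (coord x a) (E a)) = (\<Sum>a\<in>?S. scale (?R (E a)) (E a))"
    using coord_support_subset by (intro sum.cong) (auto simp: coord_def)
  also have "\<dots> = (\<Sum>b | ?R b \<noteq> 0. scale (?R b) b)"
    using sum.reindex[OF inj, of "\<lambda>b. scale (?R b) b"] by (simp add: img)
  finally show ?thesis
    by (simp add: sum_nonzero_representation_eq indep_E in_span_E)
qed

lemma coord_eq_0_imp: "(\<And>a. coord x a = 0) \<Longrightarrow> x = 0"
  using sum_coord[of x] by simp

lemma coeff_sums_iff:
  assumes "S \<subseteq> L" "0 \<in> M"
  shows "x \<in> coeff_sums scale M E S \<longleftrightarrow> (\<forall>a. coord x a \<in> M) \<and> (\<forall>a. a \<notin> S \<longrightarrow> coord x a = 0)"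
proof
  assume "x \<in> coeff_sums scale M E S"
  then obtain F f where F: "x = (\<Sum>a\<in>F. scale (f a) (E a))" "finite F" "F \<subseteq> S" "\<forall>a\<in>F. f a \<in> M"
    by (auto simp: coeff_sums_def)
  moreover have "coord x a = (if a \<in> F then f a else 0)" for a
    unfolding F(1) by (rule coord_sum_E) (use F assms in auto)
  ultimately show "(\<forall>a. coord x a \<in> M) \<and> (\<forall>a. a \<notin> S \<longrightarrow> coord x a = 0)"
    using assms(2) by auto
next
  assume *: "(\<forall>a. coord x a \<in> M) \<and> (\<forall>a. a \<notin> S \<longrightarrow> coord x a = 0)"
  show "x \<in> coeff_sums scale M E S"
    unfolding coeff_sums_def
    by (intro CollectI exI[of _ "{a. coord x a \<noteq> 0}"] exI[of _ "coord x"])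
      (use * sum_coord[of x] finite_coord in auto)
qed

end

section \<open>Bases indexed by a ranked partial order\<close>

text \<open>A partial order on the index set of the basis, with a strictly increasing rank function \<open>h\<close>.
  Such a function is all that is needed of the condition on chains.\<close>

locale ranked_based_module = based_module scale E L
  for scale :: "'r::comm_ring_1 \<Rightarrow> 'm::ab_group_add \<Rightarrow> 'm"
    and E :: "'l \<Rightarrow> 'm" and L :: "'l set" +
  fixes r :: "('l \<times> 'l) set" and h :: "'l \<Rightarrow> nat"
  assumes order: "partial_order_on L r"
    and rank: "(b, a) \<in> r \<Longrightarrow> b \<noteq> a \<Longrightarrow> h b < h a"
begin

lemma underS_subset: "underS r a \<subseteq> L"
  using order by (auto simp: underS_def partial_order_on_def preorder_on_def)

lemma ex_maximal_index:
  assumes "finite F" "F \<noteq> {}"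
  shows "\<exists>a\<in>F. \<forall>b\<in>F. a \<notin> underS r b"
proof -
  have "Max (h ` F) \<in> h ` F" using assms by (intro Max_in) auto
  then obtain a where a: "a \<in> F" "Max (h ` F) = h a" by blast
  then have "h b \<le> h a" if "b \<in> F" for b
    using Max_ge[of "h ` F" "h b"] that assms(1) by auto
  then have "a \<notin> underS r b" if "b \<in> F" for b
    using rank[of a b] that by (force simp: underS_def)
  with a(1) show ?thesis by blast
qed

text \<open>Independence: in a relation between the \<open>C a\<close>, take a maximal index \<open>b\<close> with nonzero
  coefficient; that coefficient is the coordinate of the sum at \<open>b\<close>.  Generation: induction on
  the rank puts every \<open>E a\<close> in the span of the \<open>C b\<close>.\<close>

lemma unitriangular_basis:
  assumes nontriv: "(0 :: 'r) \<noteq> 1"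
    and C: "\<And>a. a \<in> L \<Longrightarrow> C a - E a \<in> coeff_sums scale UNIV E (underS r a)"
  shows "is_basis scale C L"
proof (rule is_basisI[OF nontriv])
  have coord_C: "coord (C a) b = (if b = a then 1 else 0)" if "a \<in> L" "b \<notin> underS r a" for a b
  proof -
    have "coord (C a - E a) b = 0"
      using C[OF that(1)] that(2) by (simp add: coeff_sums_iff[OF underS_subset])
    then show ?thesis using that(1) by (simp add: coord_diff coord_E)
  qed
  fix F f a assume F: "finite F" "F \<subseteq> L" "(\<Sum>a\<in>F. scale (f a) (C a)) = 0" "a \<in> F"
  show "f a = 0"
  proof (rule ccontr)
    assume "f a \<noteq> 0"
    then have "finite {c \<in> F. f c \<noteq> 0}" "{c \<in> F. f c \<noteq> 0} \<noteq> {}" using F(1,4) by auto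
    from ex_maximal_index[OF this] obtain b
      where b: "b \<in> F" "f b \<noteq> 0" "\<forall>c\<in>F. f c \<noteq> 0 \<longrightarrow> b \<notin> underS r c" by blast
    have "0 = coord (\<Sum>a\<in>F. scale (f a) (C a)) b" by (simp add: F(3))
    also have "\<dots> = (\<Sum>c\<in>F. if b = c then f c else 0)"
      unfolding coord_sum coord_scale
    proof (rule sum.cong)
      fix c assume "c \<in> F"
      then show "f c * coord (C c) b = (if b = c then f c else 0)"
        using coord_C[of c b] b(3) F(2) by (cases "f c = 0") auto
    qed simp
    also have "\<dots> = f b" using F(1) b(1) by simp
    finally show False using b(2) by simp
  qed
next
  have "E a \<in> span (C ` L)" if "a \<in> L" for a
    using that
  proof (induction "h a" arbitrary: a rule: less_induct)
    case less
    obtain F f where F: "C a - E a = (\<Sum>b\<in>F. scale (f b) (E b))" "F \<subseteq> underS r a"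
      using C[OF less.prems] by (auto simp: coeff_sums_def)
    have "E b \<in> span (C ` L)" if "b \<in> F" for b
      using that F(2) underS_subset rank by (intro less.hyps) (auto simp: underS_def)
    then have diff: "C a - E a \<in> span (C ` L)"
      unfolding F(1) by (intro span_sum span_scale)
    have "C a \<in> span (C ` L)" using less.prems by (intro span_base) simp
    from span_diff[OF this diff] show ?case by simp
  qed
  then have "span (E ` L) \<subseteq> span (C ` L)" by (intro span_minimal subspace_span) auto
  then show "span (C ` L) = UNIV" using in_span_E by auto
qed

end

section \<open>Unitriangular semilinear involutions\<close>

text \<open>An additive involution that is semilinear over \<open>v \<mapsto> v\<^sup>-\<^sup>1\<close> and unitriangular with respect to
  the basis.\<close>

locale bar_module = ranked_based_module scale E L r h + bar: additive bar
  for scale :: "laurent_poly \<Rightarrow> 'm::ab_group_add \<Rightarrow> 'm"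
    and E :: "'l \<Rightarrow> 'm" and L :: "'l set" and r :: "('l \<times> 'l) set" and h :: "'l \<Rightarrow> nat"
    and bar :: "'m \<Rightarrow> 'm" +
  assumes bar_bar: "bar (bar x) = x"
    and bar_scale: "bar (scale f x) = scale (laurent_bar f) (bar x)"
    and bar_E: "a \<in> L \<Longrightarrow> bar (E a) - E a \<in> coeff_sums scale UNIV E (underS r a)"
begin

lemma coord_bar:
  "coord (bar y) a = (\<Sum>b | coord y b \<noteq> 0. laurent_bar (coord y b) * coord (bar (E b)) a)"
proof -
  have "bar y = (\<Sum>b | coord y b \<noteq> 0. scale (laurent_bar (coord y b)) (bar (E b)))"
    using arg_cong[OF sum_coord[of y], of bar]
    by (simp add: bar.sum bar_scale)
  then have "coord (bar y) a =
      coord (\<Sum>b | coord y b \<noteq> 0. scale (laurent_bar (coord y b)) (bar (E b))) a" by simp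
  then show ?thesis unfolding coord_sum coord_scale .
qed

lemma coord_bar_E:
  assumes "b \<in> L" "a \<notin> underS r b"
  shows "coord (bar (E b)) a = (if a = b then 1 else 0)"
proof -
  have "coord (bar (E b) - E b) a = 0"
    using bar_E[OF assms(1)] assms(2) by (simp add: coeff_sums_iff[OF underS_subset])
  then show ?thesis using assms(1) by (simp add: coord_diff coord_E)
qed

text \<open>Only \<open>bar (E a)\<close> itself contributes to the coordinate at \<open>a\<close>, since \<open>E a\<close> occurs in no
  \<open>bar (E b)\<close> with \<open>b \<noteq> a\<close> unless \<open>a\<close> lies strictly below \<open>b\<close>.\<close>

lemma coord_bar_top:
  assumes "\<And>b. coord y b \<noteq> 0 \<Longrightarrow> a \<notin> underS r b"
  shows "coord (bar y) a = laurent_bar (coord y a)"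
proof -
  have "coord (bar y) a = (\<Sum>b | coord y b \<noteq> 0. if a = b then laurent_bar (coord y b) else 0)"
  proof (subst coord_bar, rule sum.cong)
    fix b assume "b \<in> {b. coord y b \<noteq> 0}"
    then have "b \<in> L" "a \<notin> underS r b" using coord_support_subset[of y] assms by auto
    then show "laurent_bar (coord y b) * coord (bar (E b)) a =
        (if a = b then laurent_bar (coord y b) else 0)"
      by (simp add: coord_bar_E)
  qed simp
  also have "\<dots> = laurent_bar (coord y a)"
    using finite_coord[of y] by simp
  finally show ?thesis .
qed

text \<open>The involution preserves the submodule supported on a down-closed set.\<close>

lemma coord_bar_outside:
  assumes "\<And>b. b \<in> S \<Longrightarrow> underS r b \<subseteq> S" "\<And>b. b \<notin> S \<Longrightarrow> coord y b = 0" "a \<notin> S"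
  shows "coord (bar y) a = 0"
proof -
  have "coord (bar y) a = laurent_bar (coord y a)"
    using assms by (intro coord_bar_top) blast
  then show ?thesis using assms(2,3) by simp
qed

lemma bar_fixed_v_polys_eq_0:
  assumes "bar y = y" "\<And>a. coord y a \<in> v_polys_v"
  shows "y = 0"
proof (rule ccontr)
  assume "y \<noteq> 0"
  then have "{a. coord y a \<noteq> 0} \<noteq> {}" using coord_eq_0_imp by auto
  from ex_maximal_index[OF finite_coord this]
  obtain a where a: "coord y a \<noteq> 0" "\<forall>b. coord y b \<noteq> 0 \<longrightarrow> a \<notin> underS r b" by blast
  have "laurent_bar (coord y a) = coord y a"
    using coord_bar_top[of y a] a(2) assms(1) by simp
  with assms(2) a(1) show False using laurent_bar_fixed_v_polys_v by blast
qed

lemma bar_anti_fixed_decomp: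
  assumes "\<And>b. b \<in> S \<Longrightarrow> underS r b \<subseteq> S" "S \<subseteq> L" "\<And>b. b \<in> S \<Longrightarrow> h b < n"
    and "\<And>b. b \<notin> S \<Longrightarrow> coord x b = 0" "bar x = - x"
  shows "\<exists>y. (\<forall>a. coord y a \<in> v_polys_v) \<and> (\<forall>a. a \<notin> S \<longrightarrow> coord y a = 0) \<and> y - bar y = x"
  using assms
proof (induction n arbitrary: S x)
  case 0
  then have "x = 0" using coord_eq_0_imp by (metis not_less0)
  then show ?case by (intro exI[of _ 0]) (simp add: bar.zero zero_in_v_polys_v)
next
  case (Suc n)
  define T where "T = {b \<in> S. h b < n}"
  define B where "B = {b \<in> S - T. coord x b \<noteq> 0}"
  define y0 where "y0 = (\<Sum>b\<in>B. scale (laurent_pos (coord x b)) (E b))"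
  have "finite B" using finite_coord[of x] by (rule rev_finite_subset) (auto simp: B_def)
  moreover have "B \<subseteq> L" using Suc.prems(2) by (auto simp: B_def)
  ultimately have coord_y0: "coord y0 a = (if a \<in> B then laurent_pos (coord x a) else 0)" for a
    unfolding y0_def by (rule coord_sum_E)
  \<comment> \<open>All elements of \<open>S - T\<close> have the same, maximal height \<open>n\<close>.\<close>
  have top: "a \<notin> underS r b" if "a \<in> S - T" "b \<in> S" for a b
    using that Suc.prems(3)[of b] rank[of a b] by (auto simp: T_def underS_def)
  \<comment> \<open>The coordinates of \<open>y0 - bar y0\<close> and \<open>x\<close> agree on \<open>S - T\<close>, so \<open>x'\<close> is supported on \<open>T\<close>.\<close>
  define x' where "x' = x - y0 + bar y0"
  have "\<exists>y. (\<forall>a. coord y a \<in> v_polys_v) \<and> (\<forall>a. a \<notin> T \<longrightarrow> coord y a = 0) \<and> y - bar y = x'"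
  proof (rule Suc.IH)
    show "underS r b \<subseteq> T" if "b \<in> T" for b
      using that Suc.prems(1)[of b] rank by (force simp: T_def underS_def)
    show "T \<subseteq> L" "\<And>b. b \<in> T \<Longrightarrow> h b < n" using Suc.prems(2) by (auto simp: T_def)
    show "bar x' = - x'"
      by (simp add: x'_def bar.add bar.diff bar_bar Suc.prems(5))
    show "coord x' b = 0" if "b \<notin> T" for b
    proof (cases "b \<in> S")
      case True
      then have b: "b \<in> S - T" using that by simp
      have "laurent_bar (coord x b) = coord (bar x) b"
        using top[OF b] Suc.prems(4) by (intro coord_bar_top[symmetric]) blast
      then have "laurent_bar (coord x b) = - coord x b"
        by (simp add: Suc.prems(5) coord_minus)
      note decomp = laurent_pos_decomp[OF this]
      have "coord (bar y0) b = laurent_bar (coord y0 b)"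
        using top[OF b] by (intro coord_bar_top) (auto simp: coord_y0 B_def split: if_splits)
      moreover have "coord x b = coord y0 b - laurent_bar (coord y0 b)"
        using decomp b by (auto simp: coord_y0 B_def)
      ultimately show ?thesis by (simp add: x'_def coord_add coord_diff)
    next
      case False
      have "coord (bar y0) b = 0"
        by (rule coord_bar_outside[OF Suc.prems(1) _ False]) (auto simp: coord_y0 B_def)
      then show ?thesis
        using False Suc.prems(4)[of b] by (simp add: x'_def coord_add coord_diff coord_y0 B_def)
    qed
  qed
  then obtain y where y: "\<And>a. coord y a \<in> v_polys_v" "\<And>a. a \<notin> T \<Longrightarrow> coord y a = 0"
    "y - bar y = x'" by blast
  show ?case
  proof (intro exI[of _ "y + y0"] conjI allI impI)
    show "coord (y + y0) a \<in> v_polys_v" for a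
      using y(1)[of a]
      by (simp add: coord_add coord_y0 v_polys_v_add laurent_pos_in_v_polys_v)
    show "coord (y + y0) a = 0" if "a \<notin> S" for a
      using that y(2)[of a] by (simp add: coord_add coord_y0 B_def T_def)
    have "y + y0 - bar (y + y0) = (y - bar y) + y0 - bar y0"
      by (simp add: bar.add)
    then show "y + y0 - bar (y + y0) = x"
      unfolding y(3) by (simp add: x'_def)
  qed
qed

lemma canonical_exists:
  assumes "a \<in> L"
  shows "\<exists>c. bar c = c \<and> c - E a \<in> coeff_sums scale v_polys_v E (underS r a)"
proof -
  have tr: "trans r" and as: "antisym r"
    using order by (simp_all add: partial_order_on_def preorder_on_def)
  have "\<exists>y. (\<forall>b. coord y b \<in> v_polys_v) \<and> (\<forall>b. b \<notin> underS r a \<longrightarrow> coord y b = 0) \<and>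
      y - bar y = bar (E a) - E a"
  proof (rule bar_anti_fixed_decomp)
    show "underS r b \<subseteq> underS r a" if "b \<in> underS r a" for b
      using that transD[OF tr] antisymD[OF as] by (fastforce simp: underS_def)
    show "underS r a \<subseteq> L" by (rule underS_subset)
    show "h b < h a" if "b \<in> underS r a" for b
      using that rank by (auto simp: underS_def)
    show "coord (bar (E a) - E a) b = 0" if "b \<notin> underS r a" for b
      using bar_E[OF assms] that by (simp add: coeff_sums_iff[OF underS_subset])
    show "bar (bar (E a) - E a) = - (bar (E a) - E a)"
      by (simp add: bar.diff bar_bar)
  qed
  then obtain y where y: "\<And>b. coord y b \<in> v_polys_v" "\<And>b. b \<notin> underS r a \<Longrightarrow> coord y b = 0"
    "y - bar y = bar (E a) - E a" by blast
  have "bar (E a + y) = bar (E a) + y - (y - bar y)" by (simp add: bar.add)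
  also have "\<dots> = E a + y" unfolding y(3) by simp
  finally have "bar (E a + y) = E a + y" .
  moreover have "(E a + y) - E a \<in> coeff_sums scale v_polys_v E (underS r a)"
    using y(1,2) by (simp add: coeff_sums_iff[OF underS_subset zero_in_v_polys_v])
  ultimately show ?thesis by blast
qed

lemma canonical_unique:
  assumes "bar c = c" "c - E a \<in> coeff_sums scale v_polys_v E L"
    and "bar d = d" "d - E a \<in> coeff_sums scale v_polys_v E L"
  shows "c = d"
proof -
  have "coord ((c - E a) - (d - E a)) b \<in> v_polys_v" for b
    unfolding coord_diff[of "c - E a"] using assms(2,4)
    by (intro v_polys_v_diff) (simp_all add: coeff_sums_iff zero_in_v_polys_v)
  then have "c - d = 0"
    using assms(1,3) by (intro bar_fixed_v_polys_eq_0) (simp_all add: bar.diff)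
  then show ?thesis by simp
qed

end

section \<open>Heights from bounded chains\<close>

text \<open>The rank of \<open>a\<close> is the largest cardinality of a chain with top \<open>a\<close>; a longest chain with top
  \<open>b\<close> can be extended by any \<open>a\<close> strictly above \<open>b\<close>.\<close>

lemma bounded_chains_below_imp_rank:
  assumes po: "partial_order_on L r" and bc: "bounded_chains_below L r"
  shows "\<exists>h :: 'l \<Rightarrow> nat. \<forall>a b. (b, a) \<in> r \<longrightarrow> b \<noteq> a \<longrightarrow> h b < h a"
proof -
  have sub: "r \<subseteq> L \<times> L" and "refl_on L r" and tr: "trans r" and as: "antisym r"
    using po by (simp_all add: partial_order_on_def preorder_on_def)
  have rfl: "(a, a) \<in> r" if "a \<in> L" for a
    by (rule refl_onD[OF \<open>refl_on L r\<close> that])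
  define Q where "Q a = {C \<in> Chains r. a \<in> C \<and> (\<forall>c\<in>C. (c, a) \<in> r)}" for a
  define h where "h a = Max (card ` Q a)" for a
  have bounded: "\<exists>N. \<forall>C\<in>Q a. finite C \<and> card C \<le> N" if "a \<in> L" for a
  proof -
    have "\<exists>N. \<forall>C\<in>Chains r. a \<in> C \<and> (\<forall>c\<in>C. (c, a) \<in> r) \<longrightarrow> finite C \<and> card C \<le> N"
      using bc that unfolding bounded_chains_below_def by (rule bspec)
    then obtain N where
      N: "\<forall>C\<in>Chains r. a \<in> C \<and> (\<forall>c\<in>C. (c, a) \<in> r) \<longrightarrow> finite C \<and> card C \<le> N" ..
    show ?thesis by (intro exI[of _ N] ballI) (simp add: Q_def N)
  qed
  have fin: "finite (card ` Q a)" if "a \<in> L" for a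
  proof -
    from bounded[OF that] obtain N where "\<forall>C\<in>Q a. finite C \<and> card C \<le> N" ..
    then have "card ` Q a \<subseteq> {..N}" by auto
    then show ?thesis by (rule finite_subset) simp
  qed
  have "h b < h a" if ba: "(b, a) \<in> r" "b \<noteq> a" for a b
  proof -
    have L: "a \<in> L" "b \<in> L" using ba sub by auto
    have "{b} \<in> Q b" using rfl[OF L(2)] by (auto simp: Q_def Chains_def)
    then have "card ` Q b \<noteq> {}" by blast
    then have "h b \<in> card ` Q b" unfolding h_def by (rule Max_in[OF fin[OF L(2)]])
    then obtain C where C: "C \<in> Q b" "h b = card C" by blast
    have below: "(c, a) \<in> r" if "c \<in> C" for c
      using C(1) that transD[OF tr _ ba(1)] by (auto simp: Q_def)
    have "a \<notin> C" using C(1) ba antisymD[OF as ba(1)] by (auto simp: Q_def)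
    moreover have "finite C" using bounded[OF L(2)] C(1) by blast
    ultimately have "card (insert a C) = Suc (h b)" by (simp add: C(2))
    moreover have "insert a C \<in> Q a"
      using C(1) below rfl[OF L(1)] by (auto simp: Q_def Chains_def)
    then have "card (insert a C) \<le> h a"
      unfolding h_def using fin[OF L(1)] by (intro Max_ge) auto
    ultimately show ?thesis by simp
  qed
  then show ?thesis by blast
qed

section \<open>The canonical basis\<close>

theorem theorem1p1:
  fixes scale :: "laurent_poly \<Rightarrow> 'm::ab_group_add \<Rightarrow> 'm"
    and L :: "'l set"
    and r :: "('l \<times> 'l) set"
    and E :: "'l \<Rightarrow> 'm"
    and bar :: "'m \<Rightarrow> 'm"
  assumes "module scale"
    and "partial_order_on L r"
    and "bounded_chains_below L r"
    and "is_basis scale E L"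
    and "additive bar"
    and "\<And>x. bar (bar x) = x"
    and "\<And>f x. bar (scale f x) = scale (laurent_bar f) (bar x)"
    and "\<And>a. a \<in> L \<Longrightarrow> bar (E a) - E a \<in> coeff_sums scale UNIV E (underS r a)"
  shows "(\<forall>a\<in>L. \<exists>!c. bar c = c \<and> c - E a \<in> coeff_sums scale v_polys_v E L) \<and>
    (\<forall>C :: 'l \<Rightarrow> 'm.
      (\<forall>a\<in>L. bar (C a) = C a \<and> C a - E a \<in> coeff_sums scale v_polys_v E L) \<longrightarrow>
      (\<forall>a\<in>L. C a - E a \<in> coeff_sums scale v_polys_v E (underS r a)) \<and>
      is_basis scale C L)"
proof -
  obtain h :: "'l \<Rightarrow> nat" where h: "\<And>a b. (b, a) \<in> r \<Longrightarrow> b \<noteq> a \<Longrightarrow> h b < h a"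
    using bounded_chains_below_imp_rank[OF assms(2,3)] by blast
  interpret module scale by (rule assms(1))
  interpret bar_module scale E L r h bar
    by unfold_locales (use assms(2,4,6-) h additive.add[OF assms(5)] in auto)
  have mono: "x \<in> coeff_sums scale v_polys_v E (underS r a) \<Longrightarrow> x \<in> coeff_sums scale v_polys_v E L"
    "x \<in> coeff_sums scale v_polys_v E (underS r a) \<Longrightarrow> x \<in> coeff_sums scale UNIV E (underS r a)" for x a
    using underS_subset[of a] unfolding coeff_sums_def by blast+
  show ?thesis
  proof (intro conjI ballI allI impI)
    fix a assume "a \<in> L"
    then show "\<exists>!c. bar c = c \<and> c - E a \<in> coeff_sums scale v_polys_v E L"
      using canonical_exists[of a] mono(1) canonical_unique[of _ a] by blast
  next
    fix C :: "'l \<Rightarrow> 'm"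
    assume C: "\<forall>a\<in>L. bar (C a) = C a \<and> C a - E a \<in> coeff_sums scale v_polys_v E L"
    have tri: "C a - E a \<in> coeff_sums scale v_polys_v E (underS r a)" if a: "a \<in> L" for a
    proof -
      obtain c where c: "bar c = c" "c - E a \<in> coeff_sums scale v_polys_v E (underS r a)"
        using canonical_exists[OF a] by blast
      have "bar (C a) = C a" "C a - E a \<in> coeff_sums scale v_polys_v E L"
        using bspec[OF C a] by simp_all
      then have "C a = c" using c(1) mono(1)[OF c(2)] by (rule canonical_unique)
      with c show ?thesis by simp
    qed
    show "is_basis scale C L"
      by (rule unitriangular_basis) (use tri mono(2) in auto)
    show "C a - E a \<in> coeff_sums scale v_polys_v E (underS r a)" if "a \<in> L" for a
      by (rule tri[OF that])
  qed
qed

end
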